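(* Let $V$ be a finite dimensional vector space over a field $F$ of characteristic $\neq 2$, let $Q$ be a nondegenerate symmetric bilinear form on $V$, and let $e_1,\dots,e_n$ be a $Q$-orthogonal basis of $V$. Let $I,J$ be multi-indices with $I\cap J$ nonempty. Then in $C\ell(V,Q)$: 1) If $|I\cap J|$ is even, then $e_Ie_J=-e_Je_I$ if and only if $|I|$ and $|J|$ are both odd. 2) If $|I\cap J|$ is odd, then $e_Ie_J=e_Je_I$ if and only if $|I|$ and $|J|$ are both odd.
   Context: $C\ell(V,Q)$ is the Clifford algebra over $F$ of $(V,Q)$, with sign convention $v\cdot v=-Q(v,v)1$ for $v\in V$. A multi-index is a tuple $I=(i_1,\dots,i_k)$, $k\ge1$, with $1\le i_1<\dots<i_k\le n$, identified with the set of its entries; $|I|=k$ is its length (and $|I\cap J|$ is the cardinality of the intersection), and $e_I=e_{i_1}e_{i_2}\cdots e_{i_k}$. *)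

theory Defs
  imports "HOL-Algebra.Algebraic_Closure_Type" "HOL-Library.Poly_Mapping"
begin

section \<open>The free algebra on the elements of a vector space\<close>

text \<open>Words form a monoid under concatenation, written additively because
  \<^typ>\<open>'a \<Rightarrow>\<^sub>0 'b\<close> is the monoid algebra of an additively written monoid.\<close>

datatype 'v word = Word (letters: "'v list")

instantiation word :: (type) monoid_add
begin
definition zero_word :: "'v word" where "zero_word = Word []"
definition plus_word :: "'v word \<Rightarrow> 'v word \<Rightarrow> 'v word"
  where "plus_word x y = Word (letters x @ letters y)"
instance
  by standard (simp_all add: zero_word_def plus_word_def)
end

text \<open>The noncommutative polynomials over \<^typ>\<open>'f\<close> with one variable for every vector;
  no linear structure of \<^typ>\<open>'v\<close> is used yet.\<close>

type_synonym ('v, 'f) free_alg = "'v word \<Rightarrow>\<^sub>0 'f"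

definition free_algebra :: "('v, 'f::field) free_alg ring"
  where "free_algebra = ring_of_type_algebra"

definition free_vec :: "'v \<Rightarrow> ('v, 'f::field) free_alg"
  where "free_vec v = Poly_Mapping.single (Word [v]) 1"

definition free_scalar :: "'f::field \<Rightarrow> ('v, 'f) free_alg"
  where "free_scalar c = Poly_Mapping.single 0 c"


section \<open>The tensor algebra\<close>

text \<open>The tensor algebra of the vector space with scalar multiplication \<open>scale\<close> is the free
  algebra modulo the relations making \<^const>\<open>free_vec\<close> linear.
  Here and below, the structure of an \<^typ>\<open>'f\<close>-algebra is carried by the ring together with
  the homomorphism from the field into its centre (\<open>tensor_scalar\<close>, \<open>clifford_scalar\<close>);
  scalar multiplication is multiplication by the image of the scalar, so two-sided ring ideals
  are the same as two-sided algebra ideals.\<close>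

definition tensor_relations ::
  "('f::field \<Rightarrow> 'v \<Rightarrow> 'v::ab_group_add) \<Rightarrow> ('v, 'f) free_alg set"
  where "tensor_relations scale =
    {free_vec (v + w) - (free_vec v + free_vec w) | v w. True} \<union>
    {free_vec (scale c v) - free_scalar c * free_vec v | c v. True}"

definition tensor_ideal ::
  "('f::field \<Rightarrow> 'v \<Rightarrow> 'v::ab_group_add) \<Rightarrow> ('v, 'f) free_alg set"
  where "tensor_ideal scale = Idl\<^bsub>free_algebra\<^esub> (tensor_relations scale)"

definition tensor_algebra ::
  "('f::field \<Rightarrow> 'v \<Rightarrow> 'v::ab_group_add) \<Rightarrow> ('v, 'f) free_alg set ring"
  where "tensor_algebra scale = free_algebra Quot tensor_ideal scale"

definition tensor_vec ::
  "('f::field \<Rightarrow> 'v \<Rightarrow> 'v::ab_group_add) \<Rightarrow> 'v \<Rightarrow> ('v, 'f) free_alg set"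
  where "tensor_vec scale v = tensor_ideal scale +>\<^bsub>free_algebra\<^esub> free_vec v"

definition tensor_scalar ::
  "('f::field \<Rightarrow> 'v \<Rightarrow> 'v::ab_group_add) \<Rightarrow> 'f \<Rightarrow> ('v, 'f) free_alg set"
  where "tensor_scalar scale c = tensor_ideal scale +>\<^bsub>free_algebra\<^esub> free_scalar c"


section \<open>The Clifford algebra\<close>

text \<open>The sign convention is \<open>v \<cdot> v = - Q(v,v) 1\<close>.\<close>

definition clifford_relations ::
  "('f::field \<Rightarrow> 'v \<Rightarrow> 'v::ab_group_add) \<Rightarrow> ('v \<Rightarrow> 'v \<Rightarrow> 'f) \<Rightarrow> ('v, 'f) free_alg set set"
  where "clifford_relations scale Q =
    {tensor_vec scale v \<otimes>\<^bsub>tensor_algebra scale\<^esub> tensor_vec scale v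
       \<oplus>\<^bsub>tensor_algebra scale\<^esub> tensor_scalar scale (Q v v) | v. True}"

definition clifford_ideal ::
  "('f::field \<Rightarrow> 'v \<Rightarrow> 'v::ab_group_add) \<Rightarrow> ('v \<Rightarrow> 'v \<Rightarrow> 'f) \<Rightarrow> ('v, 'f) free_alg set set"
  where "clifford_ideal scale Q = Idl\<^bsub>tensor_algebra scale\<^esub> (clifford_relations scale Q)"

definition clifford_algebra ::
  "('f::field \<Rightarrow> 'v \<Rightarrow> 'v::ab_group_add) \<Rightarrow> ('v \<Rightarrow> 'v \<Rightarrow> 'f) \<Rightarrow> ('v, 'f) free_alg set set ring"
  where "clifford_algebra scale Q = tensor_algebra scale Quot clifford_ideal scale Q"

definition clifford_vec ::
  "('f::field \<Rightarrow> 'v \<Rightarrow> 'v::ab_group_add) \<Rightarrow> ('v \<Rightarrow> 'v \<Rightarrow> 'f) \<Rightarrow> 'v \<Rightarrow> ('v, 'f) free_alg set set"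
  where "clifford_vec scale Q v =
    clifford_ideal scale Q +>\<^bsub>tensor_algebra scale\<^esub> tensor_vec scale v"

definition clifford_scalar ::
  "('f::field \<Rightarrow> 'v \<Rightarrow> 'v::ab_group_add) \<Rightarrow> ('v \<Rightarrow> 'v \<Rightarrow> 'f) \<Rightarrow> 'f \<Rightarrow> ('v, 'f) free_alg set set"
  where "clifford_scalar scale Q c =
    clifford_ideal scale Q +>\<^bsub>tensor_algebra scale\<^esub> tensor_scalar scale c"


section \<open>Bilinear forms, orthogonal bases, multi-indices\<close>

definition symmetric_bilinear_form ::
  "('f::field \<Rightarrow> 'v \<Rightarrow> 'v::ab_group_add) \<Rightarrow> ('v \<Rightarrow> 'v \<Rightarrow> 'f) \<Rightarrow> bool"
  where "symmetric_bilinear_form scale Q \<longleftrightarrow>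
    (\<forall>u. Vector_Spaces.linear scale (*) (\<lambda>v. Q u v)) \<and>
    (\<forall>v. Vector_Spaces.linear scale (*) (\<lambda>u. Q u v)) \<and>
    (\<forall>u v. Q u v = Q v u)"

definition nondegenerate_form :: "('v::ab_group_add \<Rightarrow> 'v \<Rightarrow> 'f::field) \<Rightarrow> bool"
  where "nondegenerate_form Q \<longleftrightarrow> (\<forall>u. (\<forall>v. Q u v = 0) \<longrightarrow> u = 0)"

text \<open>The basis is the indexed family \<open>e 1, \<dots>, e n\<close>; injectivity excludes repetitions, which
  the basis set \<open>e ` {1..n}\<close> cannot see.\<close>

definition orthogonal_basis ::
  "('f::field \<Rightarrow> 'v \<Rightarrow> 'v::ab_group_add) \<Rightarrow> ('v \<Rightarrow> 'v \<Rightarrow> 'f) \<Rightarrow> nat \<Rightarrow> (nat \<Rightarrow> 'v) \<Rightarrow> bool"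
  where "orthogonal_basis scale Q n e \<longleftrightarrow>
    finite_dimensional_vector_space scale (e ` {1..n}) \<and>
    inj_on e {1..n} \<and>
    (\<forall>i\<in>{1..n}. \<forall>j\<in>{1..n}. i \<noteq> j \<longrightarrow> Q (e i) (e j) = 0)"

definition multi_index :: "nat \<Rightarrow> nat list \<Rightarrow> bool"
  where "multi_index n I \<longleftrightarrow> I \<noteq> [] \<and> sorted_wrt (<) I \<and> set I \<subseteq> {1..n}"

definition clifford_monomial ::
  "('f::field \<Rightarrow> 'v \<Rightarrow> 'v::ab_group_add) \<Rightarrow> ('v \<Rightarrow> 'v \<Rightarrow> 'f) \<Rightarrow> (nat \<Rightarrow> 'v) \<Rightarrow> nat list
    \<Rightarrow> ('v, 'f) free_alg set set"
  where "clifford_monomial scale Q e I =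
    foldr (\<lambda>i x. clifford_vec scale Q (e i) \<otimes>\<^bsub>clifford_algebra scale Q\<^esub> x) I
      \<one>\<^bsub>clifford_algebra scale Q\<^esub>"


section \<open>Basic properties\<close>

lemma ring_free_algebra: "ring (free_algebra :: ('v, 'f::field) free_alg ring)"
proof -
  have "\<exists>y. x + y = 0" for x :: "('v, 'f) free_alg"
    using add.right_inverse by blast
  then show ?thesis
    unfolding free_algebra_def ring_of_type_algebra_def using add.right_inverse
    by unfold_locales (auto simp: algebra_simps Units_def)
qed

lemma carrier_free_algebra [simp]: "carrier free_algebra = UNIV"
  and mult_free_algebra [simp]: "x \<otimes>\<^bsub>free_algebra\<^esub> y = x * y"
  and add_free_algebra [simp]: "x \<oplus>\<^bsub>free_algebra\<^esub> y = x + y"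
  and one_free_algebra [simp]: "\<one>\<^bsub>free_algebra\<^esub> = 1"
  and zero_free_algebra [simp]: "\<zero>\<^bsub>free_algebra\<^esub> = 0"
  by (simp_all add: free_algebra_def ring_of_type_algebra_def)

lemma ideal_tensor_ideal: "ideal (tensor_ideal scale) free_algebra"
  unfolding tensor_ideal_def by (rule ring.genideal_ideal[OF ring_free_algebra]) simp

lemma ring_tensor_algebra: "ring (tensor_algebra scale)"
  unfolding tensor_algebra_def by (rule ideal.quotient_is_ring[OF ideal_tensor_ideal])

lemma tensor_hom: "(+>\<^bsub>free_algebra\<^esub>) (tensor_ideal scale) \<in> ring_hom free_algebra (tensor_algebra scale)"
  unfolding tensor_algebra_def by (rule ideal.rcos_ring_hom[OF ideal_tensor_ideal])

lemma tensor_vec_closed: "tensor_vec scale v \<in> carrier (tensor_algebra scale)"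
  and tensor_scalar_closed: "tensor_scalar scale c \<in> carrier (tensor_algebra scale)"
  using ring_hom_closed[OF tensor_hom] by (simp_all add: tensor_vec_def tensor_scalar_def)

lemma ideal_clifford_ideal: "ideal (clifford_ideal scale Q) (tensor_algebra scale)"
proof -
  interpret T: ring "tensor_algebra scale" by (rule ring_tensor_algebra)
  show ?thesis
    unfolding clifford_ideal_def clifford_relations_def
    by (rule T.genideal_ideal) (auto intro: tensor_vec_closed tensor_scalar_closed)
qed

lemma ring_clifford_algebra: "ring (clifford_algebra scale Q)"
  unfolding clifford_algebra_def by (rule ideal.quotient_is_ring[OF ideal_clifford_ideal])

lemma clifford_hom:
  "(+>\<^bsub>tensor_algebra scale\<^esub>) (clifford_ideal scale Q)
     \<in> ring_hom (tensor_algebra scale) (clifford_algebra scale Q)"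
  unfolding clifford_algebra_def by (rule ideal.rcos_ring_hom[OF ideal_clifford_ideal])

lemma clifford_vec_closed: "clifford_vec scale Q v \<in> carrier (clifford_algebra scale Q)"
  and clifford_scalar_closed: "clifford_scalar scale Q c \<in> carrier (clifford_algebra scale Q)"
  using ring_hom_closed[OF clifford_hom] tensor_vec_closed tensor_scalar_closed
  by (fastforce simp: clifford_vec_def clifford_scalar_def)+

lemma tensor_vec_add:
  "tensor_vec scale (v + w) = tensor_vec scale v \<oplus>\<^bsub>tensor_algebra scale\<^esub> tensor_vec scale w"
proof -
  interpret ideal "tensor_ideal scale" free_algebra by (rule ideal_tensor_ideal)
  have "free_vec (v + w) - (free_vec v + free_vec w) \<in> tensor_ideal scale"
    unfolding tensor_ideal_def tensor_relations_def genideal_def by blast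
  then have "free_vec (v + w) \<in> tensor_ideal scale +>\<^bsub>free_algebra\<^esub> (free_vec v + free_vec w)"
    by (force simp: a_r_coset_def' intro: bexI[of _ "free_vec (v + w) - (free_vec v + free_vec w)"])
  then have "tensor_vec scale (v + w)
      = tensor_ideal scale +>\<^bsub>free_algebra\<^esub> (free_vec v + free_vec w)"
    unfolding tensor_vec_def by (intro a_repr_independence[OF _ _ a_subgroup, symmetric]) simp_all
  then show ?thesis
    using ring_hom_add[OF tensor_hom] by (simp add: tensor_vec_def)
qed

lemma tensor_vec_scale:
  "tensor_vec scale (scale c v)
     = tensor_scalar scale c \<otimes>\<^bsub>tensor_algebra scale\<^esub> tensor_vec scale v"
proof -
  interpret ideal "tensor_ideal scale" free_algebra by (rule ideal_tensor_ideal)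
  have "free_vec (scale c v) - free_scalar c * free_vec v \<in> tensor_ideal scale"
    unfolding tensor_ideal_def tensor_relations_def genideal_def by blast
  then have "free_vec (scale c v) \<in> tensor_ideal scale +>\<^bsub>free_algebra\<^esub> (free_scalar c * free_vec v)"
    by (force simp: a_r_coset_def' intro: bexI[of _ "free_vec (scale c v) - free_scalar c * free_vec v"])
  then have "tensor_vec scale (scale c v)
      = tensor_ideal scale +>\<^bsub>free_algebra\<^esub> (free_scalar c * free_vec v)"
    unfolding tensor_vec_def by (intro a_repr_independence[OF _ _ a_subgroup, symmetric]) simp_all
  then show ?thesis
    using ring_hom_mult[OF tensor_hom] by (simp add: tensor_vec_def tensor_scalar_def)
qed

lemma clifford_vec_add:
  "clifford_vec scale Q (v + w)
     = clifford_vec scale Q v \<oplus>\<^bsub>clifford_algebra scale Q\<^esub> clifford_vec scale Q w"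
  by (simp add: clifford_vec_def tensor_vec_add ring_hom_add[OF clifford_hom] tensor_vec_closed)

lemma clifford_vec_scale:
  "clifford_vec scale Q (scale c v)
     = clifford_scalar scale Q c \<otimes>\<^bsub>clifford_algebra scale Q\<^esub> clifford_vec scale Q v"
  by (simp add: clifford_vec_def clifford_scalar_def tensor_vec_scale
      ring_hom_mult[OF clifford_hom] tensor_vec_closed tensor_scalar_closed)

lemma clifford_vec_square:
  "clifford_vec scale Q v \<otimes>\<^bsub>clifford_algebra scale Q\<^esub> clifford_vec scale Q v
     = \<ominus>\<^bsub>clifford_algebra scale Q\<^esub> clifford_scalar scale Q (Q v v)"
proof -
  interpret I: ideal "clifford_ideal scale Q" "tensor_algebra scale" by (rule ideal_clifford_ideal)
  interpret C: ring "clifford_algebra scale Q" by (rule ring_clifford_algebra)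
  let ?t = "tensor_vec scale v" and ?s = "tensor_scalar scale (Q v v)"
  let ?r = "?t \<otimes>\<^bsub>tensor_algebra scale\<^esub> ?t \<oplus>\<^bsub>tensor_algebra scale\<^esub> ?s"
  have "?r \<in> clifford_ideal scale Q"
    unfolding clifford_ideal_def clifford_relations_def genideal_def by blast
  then have "clifford_ideal scale Q +>\<^bsub>tensor_algebra scale\<^esub> ?r = \<zero>\<^bsub>clifford_algebra scale Q\<^esub>"
    using I.a_rcos_zero[OF ideal_clifford_ideal]
    by (simp add: clifford_algebra_def FactRing_def)
  moreover have "clifford_ideal scale Q +>\<^bsub>tensor_algebra scale\<^esub> ?r =
      clifford_vec scale Q v \<otimes>\<^bsub>clifford_algebra scale Q\<^esub> clifford_vec scale Q v
        \<oplus>\<^bsub>clifford_algebra scale Q\<^esub> clifford_scalar scale Q (Q v v)"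
    by (simp add: ring_hom_add[OF clifford_hom] ring_hom_mult[OF clifford_hom]
        tensor_vec_closed tensor_scalar_closed clifford_vec_def clifford_scalar_def)
  ultimately show ?thesis
    by (metis C.add.inv_equality C.m_closed clifford_vec_closed clifford_scalar_closed)
qed

end

theory Submission
  imports Defs "HOL-Library.Function_Algebras"
begin

text \<open>
  Distinct basis vectors anticommute in the Clifford algebra, so moving \<open>e_I\<close> past \<open>e_J\<close> costs one
  sign for every pair \<open>(i, j)\<close> with \<open>i \<noteq> j\<close>:
  \<open>e_I e_J = (-1)^(|I| |J| - |I \<inter> J|) e_J e_I\<close>. Nondegeneracy makes every \<open>e_i\<close>, hence every
  monomial, invertible, so for \<open>2 \<noteq> 0\<close> the sign can be read off as soon as \<open>1 \<noteq> 0\<close> in the Clifford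
  algebra. The latter holds because the algebra acts on the nonzero space of functions on subsets
  of \<open>{1..n}\<close>, where \<open>e_i\<close> inserts or deletes \<open>i\<close> up to a factor.
\<close>

section \<open>Modules over the Clifford algebra\<close>

lemma letters_zero [simp]: "letters 0 = []"
  by (simp add: zero_word_def)

lemma poly_mapping_induct [case_names zero single add]:
  fixes x :: "'a \<Rightarrow>\<^sub>0 'b::monoid_add"
  assumes zero: "P 0"
    and single: "\<And>k c. P (Poly_Mapping.single k c)"
    and add: "\<And>x y. P x \<Longrightarrow> P y \<Longrightarrow> P (x + y)"
  shows "P x"
proof (induction x rule: update_induct)
  case (update x k c)
  \<comment> \<open>\<open>update_induct\<close> supplies \<open>k\<close> outside the keys of
    \<open>x\<close>, so overwriting at \<open>k\<close> is adding a monomial.\<close>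
  have "Poly_Mapping.update k c x = x + Poly_Mapping.single k c"
    using update.hyps(1)
    by (intro poly_mapping_eqI) (auto simp: lookup_update lookup_add lookup_single in_keys_iff)
  then show ?case
    using add[OF update.IH single[of k c]] by simp
qed (rule zero)

text \<open>Each \<open>\<rho> v\<close> is linear on the module, but nothing links different
  \<open>v\<close>: the free algebra has an independent variable for every vector.\<close>

locale operator_family = vector_space scaleM
  for scaleM :: "'f::field \<Rightarrow> 'm::ab_group_add \<Rightarrow> 'm" +
  fixes \<rho> :: "'v \<Rightarrow> 'm \<Rightarrow> 'm"
  assumes linear_op: "Vector_Spaces.linear scaleM scaleM (\<rho> v)"
begin

text \<open>The evaluation of noncommutative polynomials that substitutes \<open>\<rho> v\<close>
  for the variable \<open>v\<close>; a word acts by composition, its last letter first.\<close>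

definition act :: "('v, 'f) free_alg \<Rightarrow> 'm \<Rightarrow> 'm"
  where "act x m = (\<Sum>w\<in>Poly_Mapping.keys x.
    scaleM (Poly_Mapping.lookup x w) (foldr \<rho> (letters w) m))"

lemma linear_foldr: "Vector_Spaces.linear scaleM scaleM (foldr \<rho> ws)"
proof (induction ws)
  case Nil
  show ?case by (simp add: linear_id[unfolded id_def] id_def)
next
  case (Cons v ws)
  then show ?case
    using Vector_Spaces.linear_compose[OF Cons linear_op[of v]] by (simp add: comp_def)
qed

lemmas foldr_add = module_hom.add[OF linear_foldr[folded module_hom_iff_linear]]
  and foldr_scale = module_hom.scale[OF linear_foldr[folded module_hom_iff_linear]]

text \<open>Lets different polynomials be summed over one common index set, since words outside the
  support have coefficient 0.\<close>

lemma act_superset: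
  assumes "finite A" "Poly_Mapping.keys x \<subseteq> A"
  shows "act x m = (\<Sum>w\<in>A. scaleM (Poly_Mapping.lookup x w) (foldr \<rho> (letters w) m))"
  unfolding act_def using assms by (intro sum.mono_neutral_left) (auto simp: in_keys_iff)

lemma act_single: "act (Poly_Mapping.single w c) m = scaleM c (foldr \<rho> (letters w) m)"
  by (simp add: act_superset[of "{w}"])

lemma act_zero [simp]: "act 0 m = 0"
  by (simp add: act_def)

lemma act_plus: "act (x + y) m = act x m + act y m"
  using keys_add[of x y]
  by (simp add: act_superset[of "Poly_Mapping.keys x \<union> Poly_Mapping.keys y"] lookup_add
      scale_left_distrib sum.distrib)

lemma act_uminus: "act (- x) m = - act x m"
  using act_plus[of "- x" x m] by (simp add: eq_neg_iff_add_eq_0)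

lemma act_diff: "act (x - y) m = act x m - act y m"
  using act_plus[of x "- y" m] by (simp add: act_uminus)

lemma act_add_right: "act x (m + m') = act x m + act x m'"
  by (simp add: act_def foldr_add scale_right_distrib sum.distrib)

lemma act_zero_right [simp]: "act x 0 = 0"
  using act_add_right[of x 0 0] by simp

text \<open>Both sides are additive in \<open>x\<close> and in \<open>y\<close>. On monomials,
  concatenation of words becomes composition, and linearity of \<open>foldr \<rho>\<close> moves the
  inner scalar out.\<close>

lemma act_times: "act (x * y) m = act x (act y m)"
proof (induction x rule: poly_mapping_induct)
  case (single w c)
  show ?case
  proof (induction y rule: poly_mapping_induct)
    case (single w' c')
    show ?case
      by (simp add: mult_single act_single plus_word_def foldr_scale)
  qed (simp_all add: distrib_left act_plus act_add_right act_single[of w c]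
        foldr_add scale_right_distrib module_hom.zero[OF linear_foldr[folded module_hom_iff_linear]])
qed (simp_all add: distrib_right act_plus)

lemma act_one: "act 1 m = m"
  using act_single[of 0 1 m] by simp

lemma act_free_vec: "act (free_vec v) m = \<rho> v m"
  by (simp add: free_vec_def act_single)

lemma act_free_scalar: "act (free_scalar c) m = scaleM c m"
  by (simp add: free_scalar_def act_single)

text \<open>The kernel of the evaluation. It is two-sided because \<open>act\<close> turns products
  into compositions and every operator sends 0 to 0.\<close>

lemma ideal_annihilator: "ideal {x. \<forall>m. act x m = 0} free_algebra"
proof (rule idealI[OF ring_free_algebra])
  interpret F: ring "free_algebra :: ('v, 'f) free_alg ring" by (rule ring_free_algebra)
  have neg: "inv\<^bsub>add_monoid free_algebra\<^esub> x = - x" for x :: "('v, 'f) free_alg"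
    unfolding a_inv_def[symmetric] by (rule F.minus_equality) simp_all
  show "subgroup {x. \<forall>m. act x m = 0} (add_monoid free_algebra)"
  proof (rule subgroup.intro)
    fix x assume "x \<in> {x. \<forall>m. act x m = 0}"
    then show "inv\<^bsub>add_monoid free_algebra\<^esub> x \<in> {x. \<forall>m. act x m = 0}"
      unfolding neg by (simp add: act_uminus)
  qed (auto simp: act_plus)
qed (auto simp: act_times)

end

text \<open>The added assumptions are the relations imposed by the two quotients: linearity in the
  vector for the tensor algebra, and the signed square for the Clifford algebra.\<close>

locale clifford_module = operator_family scaleM \<rho>
  for scaleM :: "'f::field \<Rightarrow> 'm::ab_group_add \<Rightarrow> 'm"
    and \<rho> :: "'v::ab_group_add \<Rightarrow> 'm \<Rightarrow> 'm" +
  fixes scale :: "'f \<Rightarrow> 'v \<Rightarrow> 'v"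
    and Q :: "'v \<Rightarrow> 'v \<Rightarrow> 'f"
  assumes op_add: "\<rho> (v + w) m = \<rho> v m + \<rho> w m"
    and op_scale: "\<rho> (scale c v) m = scaleM c (\<rho> v m)"
    and op_square: "\<rho> v (\<rho> v m) = scaleM (- Q v v) m"
begin

lemma tensor_ideal_act:
  assumes "x \<in> tensor_ideal scale"
  shows "act x m = 0"
proof -
  interpret F: ring "free_algebra :: ('v, 'f) free_alg ring" by (rule ring_free_algebra)
  have "tensor_relations scale \<subseteq> {x. \<forall>m. act x m = 0}"
    by (auto simp: tensor_relations_def act_diff act_plus act_times act_free_vec act_free_scalar
        op_add op_scale)
  then show ?thesis
    using F.genideal_minimal[OF ideal_annihilator] assms unfolding tensor_ideal_def by blast
qed

text \<open>Phrased through representatives in the free algebra, so that no action of the quotients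
  has to be defined. The image of the annihilator in the tensor algebra is an ideal containing the
  Clifford relations, hence contains the ideal they generate.\<close>

lemma clifford_ideal_act:
  assumes "tensor_ideal scale +>\<^bsub>free_algebra\<^esub> x \<in> clifford_ideal scale Q"
  shows "act x m = 0"
proof -
  let ?q = "(+>\<^bsub>free_algebra\<^esub>) (tensor_ideal scale)"
  interpret F: ring "free_algebra :: ('v, 'f) free_alg ring" by (rule ring_free_algebra)
  interpret T: ring "tensor_algebra scale" by (rule ring_tensor_algebra)
  interpret I: ideal "tensor_ideal scale" free_algebra by (rule ideal_tensor_ideal)
  have "clifford_relations scale Q \<subseteq> ?q ` {x. \<forall>m. act x m = 0}"
  proof
    fix r assume "r \<in> clifford_relations scale Q"
    then obtain v where r: "r = tensor_vec scale v \<otimes>\<^bsub>tensor_algebra scale\<^esub> tensor_vec scale v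
       \<oplus>\<^bsub>tensor_algebra scale\<^esub> tensor_scalar scale (Q v v)"
      unfolding clifford_relations_def by blast
    have "r = ?q (free_vec v * free_vec v + free_scalar (Q v v))"
      by (simp add: r tensor_vec_def tensor_scalar_def ring_hom_add[OF tensor_hom, simplified]
          ring_hom_mult[OF tensor_hom, simplified])
    moreover have "act (free_vec v * free_vec v + free_scalar (Q v v)) m = 0" for m
      by (simp add: act_plus act_times act_free_vec act_free_scalar op_square)
    ultimately show "r \<in> ?q ` {x. \<forall>m. act x m = 0}"
      by blast
  qed
  moreover have "ideal (?q ` {x. \<forall>m. act x m = 0}) (tensor_algebra scale)"
    unfolding tensor_algebra_def
    by (rule F.ring_ideal_imp_quot_ideal[OF ideal_tensor_ideal ideal_annihilator])
  ultimately have "clifford_ideal scale Q \<subseteq> ?q ` {x. \<forall>m. act x m = 0}"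
    unfolding clifford_ideal_def by (intro T.genideal_minimal)
  with assms have "?q x \<in> ?q ` {x. \<forall>m. act x m = 0}"
    by blast
  then obtain y where xy: "?q x = ?q y" and y: "y \<in> {x. \<forall>m. act x m = 0}"
    by (rule imageE)
  \<comment> \<open>Equal cosets determine \<open>x\<close> only up to an element of the tensor
    ideal, and that element acts as zero too.\<close>
  have "x \<in> ?q y"
    using I.a_rcos_self[of x] xy by simp
  then obtain h where "h \<in> tensor_ideal scale" "x = h + y"
    by (auto simp: a_r_coset_def')
  then show ?thesis
    using y by (simp add: act_plus tensor_ideal_act)
qed

text \<open>If 1 = 0, then 1 lies in the Clifford ideal and so annihilates the module, yet it acts
  as the identity.\<close>

lemma clifford_one_not_zero:
  assumes "m \<noteq> (0 :: 'm)"
  shows "\<one>\<^bsub>clifford_algebra scale Q\<^esub> \<noteq> \<zero>\<^bsub>clifford_algebra scale Q\<^esub>"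
proof
  assume eq: "\<one>\<^bsub>clifford_algebra scale Q\<^esub> = \<zero>\<^bsub>clifford_algebra scale Q\<^esub>"
  interpret T: ring "tensor_algebra scale" by (rule ring_tensor_algebra)
  interpret I: ideal "clifford_ideal scale Q" "tensor_algebra scale" by (rule ideal_clifford_ideal)
  have "\<one>\<^bsub>tensor_algebra scale\<^esub> \<in> clifford_ideal scale Q"
    using I.a_rcos_self[OF T.one_closed] eq by (simp add: clifford_algebra_def FactRing_def)
  moreover have "\<one>\<^bsub>tensor_algebra scale\<^esub> = tensor_ideal scale +>\<^bsub>free_algebra\<^esub> 1"
    using ring_hom_one[OF tensor_hom, of scale] by simp
  ultimately have "act 1 m = 0"
    by (simp add: clifford_ideal_act)
  with assms show False
    by (simp add: act_one)
qed

end

section \<open>Anticommuting families\<close>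

context ring
begin

text \<open>Multiplication by (-1)^k, phrased for a ring without chosen scalars.\<close>

definition alt :: "nat \<Rightarrow> 'a \<Rightarrow> 'a"
  where "alt k y = (if even k then y else \<ominus> y)"

lemma alt_closed [simp]: "y \<in> carrier R \<Longrightarrow> alt k y \<in> carrier R"
  by (simp add: alt_def)

lemma alt_alt: "y \<in> carrier R \<Longrightarrow> alt k (alt l y) = alt (k + l) y"
  by (simp add: alt_def)

lemma alt_mult_left: "y \<in> carrier R \<Longrightarrow> z \<in> carrier R \<Longrightarrow> alt k y \<otimes> z = alt k (y \<otimes> z)"
  by (simp add: alt_def l_minus)

lemma alt_mult_right: "y \<in> carrier R \<Longrightarrow> z \<in> carrier R \<Longrightarrow> y \<otimes> alt k z = alt k (y \<otimes> z)"
  by (simp add: alt_def r_minus)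

lemma foldr_mult_closed:
  "(\<And>i. i \<in> set I \<Longrightarrow> x i \<in> carrier R) \<Longrightarrow> foldr (\<lambda>i y. x i \<otimes> y) I \<one> \<in> carrier R"
  by (induction I) auto

text \<open>The right inverses of the factors, multiplied in reverse order, give a right inverse of
  the product.\<close>

lemma foldr_mult_right_invertible:
  assumes "\<And>i. i \<in> set I \<Longrightarrow> x i \<in> carrier R"
    and "\<And>i. i \<in> set I \<Longrightarrow> \<exists>r\<in>carrier R. x i \<otimes> r = \<one>"
  shows "\<exists>r\<in>carrier R. foldr (\<lambda>i y. x i \<otimes> y) I \<one> \<otimes> r = \<one>"
  using assms
proof (induction I)
  case (Cons i I)
  let ?p = "foldr (\<lambda>i y. x i \<otimes> y) I \<one>"
  have closed: "x i \<in> carrier R" "?p \<in> carrier R"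
    using Cons.prems(1) by (auto intro: foldr_mult_closed)
  obtain r where r: "r \<in> carrier R" "x i \<otimes> r = \<one>"
    using Cons.prems(2) by auto
  obtain s where s: "s \<in> carrier R" "?p \<otimes> s = \<one>"
    using Cons by auto
  have "(x i \<otimes> ?p) \<otimes> (s \<otimes> r) = x i \<otimes> ((?p \<otimes> s) \<otimes> r)"
    using closed r(1) s(1) by (simp add: m_assoc)
  also have "\<dots> = \<one>"
    using r s by simp
  finally show ?case
    using r(1) s(1) by (auto intro!: bexI[of _ "s \<otimes> r"])
qed auto

end

locale anticommuting_family = ring R for R (structure) +
  fixes A :: "'i set" and x :: "'i \<Rightarrow> 'a"
  assumes closed [simp]: "i \<in> A \<Longrightarrow> x i \<in> carrier R"
    and anticommute: "i \<in> A \<Longrightarrow> j \<in> A \<Longrightarrow> i \<noteq> j \<Longrightarrow> x i \<otimes> x j = \<ominus> (x j \<otimes> x i)"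
begin

abbreviation monomial :: "'i list \<Rightarrow> 'a"
  where "monomial I \<equiv> foldr (\<lambda>i y. x i \<otimes> y) I \<one>"

lemma monomial_closed: "set I \<subseteq> A \<Longrightarrow> monomial I \<in> carrier R"
  by (rule foldr_mult_closed) auto

lemma generator_monomial:
  assumes "i \<in> A" "set J \<subseteq> A"
  shows "x i \<otimes> monomial J = alt (length (filter (\<lambda>j. j \<noteq> i) J)) (monomial J \<otimes> x i)"
  using assms(2)
proof (induction J)
  case Nil
  then show ?case using assms(1) by (simp add: alt_def)
next
  case (Cons j J)
  have closed': "x i \<in> carrier R" "x j \<in> carrier R" "monomial J \<in> carrier R"
    using assms(1) Cons.prems by (auto intro: monomial_closed)
  \<comment> \<open>The exponent is 0 for \<open>j = i\<close>, since a generator commutes with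
    itself.\<close>
  have "x i \<otimes> x j = alt (if j = i then 0 else 1) (x j \<otimes> x i)"
    using anticommute[of i j] assms(1) Cons.prems by (simp add: alt_def)
  then have "x i \<otimes> monomial (j # J) = alt (if j = i then 0 else 1) (x j \<otimes> x i) \<otimes> monomial J"
    using closed' by (simp flip: m_assoc)
  also have "\<dots> = alt (if j = i then 0 else 1) (x j \<otimes> (x i \<otimes> monomial J))"
    using closed' by (simp add: alt_mult_left m_assoc)
  also have "\<dots> = alt (length (filter (\<lambda>j. j \<noteq> i) (j # J))) (monomial (j # J) \<otimes> x i)"
    using closed' Cons by (simp add: alt_mult_right alt_alt m_assoc)
  finally show ?case .
qed

text \<open>The letters of \<open>I\<close> pass the whole of \<open>J\<close> one at a time,
  starting from the last; each contributes the sign from \<open>generator_monomial\<close>.\<close>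

lemma monomial_commute:
  assumes "set I \<subseteq> A" "set J \<subseteq> A"
  shows "monomial I \<otimes> monomial J
    = alt (\<Sum>i\<leftarrow>I. length (filter (\<lambda>j. j \<noteq> i) J)) (monomial J \<otimes> monomial I)"
  using assms(1)
proof (induction I)
  case Nil
  then show ?case using monomial_closed[OF assms(2)] by (simp add: alt_def)
next
  case (Cons i I)
  have closed': "x i \<in> carrier R" "monomial I \<in> carrier R" "monomial J \<in> carrier R"
    using assms(2) Cons.prems by (auto intro: monomial_closed)
  let ?k = "length (filter (\<lambda>j. j \<noteq> i) J)" and ?l = "\<Sum>i\<leftarrow>I. length (filter (\<lambda>j. j \<noteq> i) J)"
  have "monomial (i # I) \<otimes> monomial J = alt ?l ((x i \<otimes> monomial J) \<otimes> monomial I)"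
    using closed' Cons by (simp add: alt_mult_right m_assoc)
  also have "\<dots> = alt (?l + ?k) (monomial J \<otimes> monomial (i # I))"
    using closed' generator_monomial[of i J] assms(2) Cons.prems
    by (simp add: alt_mult_left alt_alt m_assoc)
  finally show ?case
    by (simp add: add.commute)
qed

end

text \<open>Counts pairs of entries: the unequal ones plus the equal ones, of which there is one per
  common entry. The additive form avoids truncated subtraction.\<close>

lemma sum_list_filter_neq:
  assumes "distinct I" "distinct J"
  shows "(\<Sum>i\<leftarrow>I. length (filter (\<lambda>j. j \<noteq> i) J)) + card (set I \<inter> set J) = length I * length J"
  using assms(1)
proof (induction I)
  case (Cons i I)
  have "length (filter (\<lambda>j. j \<noteq> i) J) = card (set J - {i})"
    using assms(2) by (simp add: set_diff_eq flip: distinct_card)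
  then have *: "length (filter (\<lambda>j. j \<noteq> i) J) + (if i \<in> set J then 1 else 0) = length J"
    using assms(2) card_Suc_Diff1[of "set J" i] by (auto simp: distinct_card)
  have "set (i # I) \<inter> set J = (if i \<in> set J then insert i (set I \<inter> set J) else set I \<inter> set J)"
    by auto
  then have "card (set (i # I) \<inter> set J) = (if i \<in> set J then 1 else 0) + card (set I \<inter> set J)"
    using Cons.prems by simp
  then show ?case
    using Cons * by simp
qed simp

section \<open>Relations in the Clifford algebra\<close>

lemma free_scalar_hom:
  "free_scalar (a + b) = free_scalar a + free_scalar b"
  "free_scalar (a * b) = free_scalar a * free_scalar b"
  "free_scalar 1 = 1"
  by (simp_all add: free_scalar_def single_add mult_single)

lemma clifford_scalar_add:
  "clifford_scalar scale Q (a + b)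
    = clifford_scalar scale Q a \<oplus>\<^bsub>clifford_algebra scale Q\<^esub> clifford_scalar scale Q b"
  using ring_hom_add[OF tensor_hom, of "free_scalar a" "free_scalar b" scale]
    ring_hom_add[OF clifford_hom tensor_scalar_closed tensor_scalar_closed]
  by (simp add: clifford_scalar_def tensor_scalar_def free_scalar_hom)

lemma clifford_scalar_mult:
  "clifford_scalar scale Q (a * b)
    = clifford_scalar scale Q a \<otimes>\<^bsub>clifford_algebra scale Q\<^esub> clifford_scalar scale Q b"
  using ring_hom_mult[OF tensor_hom, of "free_scalar a" "free_scalar b" scale]
    ring_hom_mult[OF clifford_hom tensor_scalar_closed tensor_scalar_closed]
  by (simp add: clifford_scalar_def tensor_scalar_def free_scalar_hom)

lemma clifford_scalar_one:
  "clifford_scalar scale Q 1 = \<one>\<^bsub>clifford_algebra scale Q\<^esub>"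
  using ring_hom_one[OF tensor_hom, of scale] ring_hom_one[OF clifford_hom, of scale Q]
  by (simp add: clifford_scalar_def tensor_scalar_def free_scalar_hom)

lemma clifford_scalar_zero:
  "clifford_scalar scale Q 0 = \<zero>\<^bsub>clifford_algebra scale Q\<^esub>"
proof -
  interpret C: ring "clifford_algebra scale Q" by (rule ring_clifford_algebra)
  show ?thesis
    using clifford_scalar_add[of scale Q 0 0] clifford_scalar_closed[of scale Q 0] by simp
qed

lemma clifford_scalar_uminus:
  "clifford_scalar scale Q (- a) = \<ominus>\<^bsub>clifford_algebra scale Q\<^esub> clifford_scalar scale Q a"
proof -
  interpret C: ring "clifford_algebra scale Q" by (rule ring_clifford_algebra)
  show ?thesis
    by (rule C.minus_equality[symmetric])
      (simp_all add: clifford_scalar_closed clifford_scalar_zero flip: clifford_scalar_add)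
qed

text \<open>Polarization: expand the square of \<open>u + v\<close> and cancel the squares of
  \<open>u\<close> and \<open>v\<close>.\<close>

lemma clifford_vec_anticommute:
  assumes "symmetric_bilinear_form scale Q" "Q u v = 0"
  shows "clifford_vec scale Q u \<otimes>\<^bsub>clifford_algebra scale Q\<^esub> clifford_vec scale Q v
    = \<ominus>\<^bsub>clifford_algebra scale Q\<^esub>
        (clifford_vec scale Q v \<otimes>\<^bsub>clifford_algebra scale Q\<^esub> clifford_vec scale Q u)"
proof -
  interpret C: ring "clifford_algebra scale Q" by (rule ring_clifford_algebra)
  let ?C = "clifford_algebra scale Q" and ?u = "clifford_vec scale Q u"
    and ?v = "clifford_vec scale Q v" and ?s = "clifford_scalar scale Q"
  note closed = clifford_vec_closed[of scale Q] clifford_scalar_closed[of scale Q]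
  have "Q (x + y) z = Q x z + Q y z" "Q z (x + y) = Q z x + Q z y" for x y z
    using assms(1) module_hom.add[of scale "(*)" "\<lambda>v. Q v z"] module_hom.add[of scale "(*)" "Q z"]
    unfolding symmetric_bilinear_form_def module_hom_iff_linear by blast+
  moreover have "Q v u = 0"
    using assms unfolding symmetric_bilinear_form_def by metis
  ultimately have "Q (u + v) (u + v) = Q u u + Q v v"
    using assms(2) by simp
  then have "(?u \<oplus>\<^bsub>?C\<^esub> ?v) \<otimes>\<^bsub>?C\<^esub> (?u \<oplus>\<^bsub>?C\<^esub> ?v) = \<ominus>\<^bsub>?C\<^esub> (?s (Q u u) \<oplus>\<^bsub>?C\<^esub> ?s (Q v v))"
    using clifford_vec_square[of scale Q "u + v"]
    by (simp add: clifford_vec_add clifford_scalar_add)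
  then have "(?u \<otimes>\<^bsub>?C\<^esub> ?u \<oplus>\<^bsub>?C\<^esub> ?v \<otimes>\<^bsub>?C\<^esub> ?v) \<oplus>\<^bsub>?C\<^esub> (?u \<otimes>\<^bsub>?C\<^esub> ?v \<oplus>\<^bsub>?C\<^esub> ?v \<otimes>\<^bsub>?C\<^esub> ?u)
      = ?u \<otimes>\<^bsub>?C\<^esub> ?u \<oplus>\<^bsub>?C\<^esub> ?v \<otimes>\<^bsub>?C\<^esub> ?v"
    using closed by (simp add: C.l_distr C.r_distr C.minus_add clifford_vec_square C.a_ac)
  then have "?u \<otimes>\<^bsub>?C\<^esub> ?v \<oplus>\<^bsub>?C\<^esub> ?v \<otimes>\<^bsub>?C\<^esub> ?u = \<zero>\<^bsub>?C\<^esub>"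
    using closed by (metis C.add.l_cancel_one C.add.m_closed C.m_closed)
  then show ?thesis
    using closed by (metis C.minus_equality C.m_closed)
qed

text \<open>As v squares to -Q(v,v), the element v times the scalar -1/Q(v,v) is a right
  inverse.\<close>

lemma clifford_vec_right_invertible:
  assumes "Q v v \<noteq> 0"
  shows "\<exists>r\<in>carrier (clifford_algebra scale Q).
    clifford_vec scale Q v \<otimes>\<^bsub>clifford_algebra scale Q\<^esub> r = \<one>\<^bsub>clifford_algebra scale Q\<^esub>"
proof
  interpret C: ring "clifford_algebra scale Q" by (rule ring_clifford_algebra)
  let ?C = "clifford_algebra scale Q" and ?v = "clifford_vec scale Q v"
    and ?s = "clifford_scalar scale Q (- inverse (Q v v))"
  have "?v \<otimes>\<^bsub>?C\<^esub> (?v \<otimes>\<^bsub>?C\<^esub> ?s) = clifford_scalar scale Q (- Q v v * - inverse (Q v v))"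
    unfolding clifford_scalar_mult clifford_scalar_uminus[of scale Q "Q v v"]
    by (simp add: clifford_vec_closed clifford_scalar_closed clifford_vec_square flip: C.m_assoc)
  then show "?v \<otimes>\<^bsub>?C\<^esub> (?v \<otimes>\<^bsub>?C\<^esub> ?s) = \<one>\<^bsub>?C\<^esub>"
    using assms by (simp add: clifford_scalar_one)
  show "?v \<otimes>\<^bsub>?C\<^esub> ?s \<in> carrier ?C"
    by (simp add: clifford_vec_closed clifford_scalar_closed)
qed

text \<open>From z + z = 0, multiplying by \<open>r\<close> on the right gives 1 + 1 = 0; but 2 is a
  unit of the field, so its image would make 1 vanish.\<close>

lemma clifford_not_eq_minus:
  fixes Q :: "'v::ab_group_add \<Rightarrow> 'v \<Rightarrow> 'f::field"
  assumes "(2 :: 'f) \<noteq> 0"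
    and "\<one>\<^bsub>clifford_algebra scale Q\<^esub> \<noteq> \<zero>\<^bsub>clifford_algebra scale Q\<^esub>"
    and z: "z \<in> carrier (clifford_algebra scale Q)"
    and r: "r \<in> carrier (clifford_algebra scale Q)"
    and inv: "z \<otimes>\<^bsub>clifford_algebra scale Q\<^esub> r = \<one>\<^bsub>clifford_algebra scale Q\<^esub>"
  shows "z \<noteq> \<ominus>\<^bsub>clifford_algebra scale Q\<^esub> z"
proof
  interpret C: ring "clifford_algebra scale Q" by (rule ring_clifford_algebra)
  let ?C = "clifford_algebra scale Q" and ?s = "clifford_scalar scale Q"
  assume "z = \<ominus>\<^bsub>?C\<^esub> z"
  then have "z \<oplus>\<^bsub>?C\<^esub> z = \<zero>\<^bsub>?C\<^esub>"
    using C.r_neg[OF z] by simp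
  then have "\<one>\<^bsub>?C\<^esub> \<oplus>\<^bsub>?C\<^esub> \<one>\<^bsub>?C\<^esub> = \<zero>\<^bsub>?C\<^esub>"
    using C.l_distr[OF z z r] inv r by simp
  then have "?s 2 = \<zero>\<^bsub>?C\<^esub>"
    using clifford_scalar_add[of scale Q 1 1] by (simp add: clifford_scalar_one)
  then have "?s (2 * inverse 2) = \<zero>\<^bsub>?C\<^esub>"
    unfolding clifford_scalar_mult by (simp add: clifford_scalar_closed)
  with assms(1,2) show False
    by (simp add: clifford_scalar_one)
qed

section \<open>The Fock module\<close>

text \<open>Off-diagonal terms cancel in pairs; in the induction the new row cancels against the new
  column. It serves both for squares of operators and for the diagonal form of
  \<open>Q\<close>.\<close>

lemma sum_sum_antisymmetric:
  fixes a :: "'i \<Rightarrow> 'i \<Rightarrow> 'b::ab_group_add"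
  assumes "finite A" and "\<And>i j. i \<in> A \<Longrightarrow> j \<in> A \<Longrightarrow> i \<noteq> j \<Longrightarrow> a i j + a j i = 0"
  shows "(\<Sum>i\<in>A. \<Sum>j\<in>A. a i j) = (\<Sum>i\<in>A. a i i)"
  using assms
proof (induction A rule: finite_induct)
  case (insert k A)
  have "(\<Sum>j\<in>A. a k j) + (\<Sum>i\<in>A. a i k) = (\<Sum>i\<in>A. a k i + a i k)"
    by (simp add: sum.distrib)
  also have "\<dots> = 0"
    using insert.hyps insert.prems by (intro sum.neutral) auto
  finally have "(\<Sum>j\<in>A. a k j) + (\<Sum>i\<in>A. a i k) = 0" .
  moreover have "(\<Sum>i\<in>A. \<Sum>j\<in>A. a i j) = (\<Sum>i\<in>A. a i i)"
    using insert by blast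
  moreover have "(\<Sum>i\<in>insert k A. \<Sum>j\<in>insert k A. a i j)
      = a k k + ((\<Sum>j\<in>A. a k j) + (\<Sum>i\<in>A. a i k)) + (\<Sum>i\<in>A. \<Sum>j\<in>A. a i j)"
    using insert.hyps by (simp add: sum.distrib algebra_simps)
  ultimately show ?case
    using insert.hyps by simp
qed simp

section \<open>Operators inserting or deleting one element of a set\<close>

definition fock_sign :: "nat \<Rightarrow> nat set \<Rightarrow> 'f::field"
  where "fock_sign i S = (-1) ^ card {j \<in> S. j < i}"

definition toggle :: "nat \<Rightarrow> nat set \<Rightarrow> nat set"
  where "toggle i S = (if i \<in> S then S - {i} else insert i S)"

text \<open>Modelled on left multiplication by e_i on the monomials e_S. The indicator of a set
  without \<open>i\<close> goes to that of the set with \<open>i\<close> inserted, up to sign;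
  deleting \<open>i\<close> brings the factor \<open>- q i\<close>, the square of e_i.
  \<open>fock_sign\<close> records the generators of smaller index that e_i has to pass.\<close>

definition fock_op :: "(nat \<Rightarrow> 'f::field) \<Rightarrow> nat \<Rightarrow> (nat set \<Rightarrow> 'f) \<Rightarrow> nat set \<Rightarrow> 'f"
  where "fock_op q i \<phi> S = fock_sign i S * (if i \<in> S then 1 else - q i) * \<phi> (toggle i S)"

lemma toggle_toggle [simp]: "toggle i (toggle i S) = S"
  by (auto simp: toggle_def)

lemma toggle_commute: "toggle i (toggle j S) = toggle j (toggle i S)"
  by (auto simp: toggle_def)

lemma mem_toggle: "j \<in> toggle i S \<longleftrightarrow> (if j = i then i \<notin> S else j \<in> S)"
  by (auto simp: toggle_def)

lemma fock_sign_square: "fock_sign i S * fock_sign i S = 1"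
  by (simp add: fock_sign_def flip: power_mult_distrib)

text \<open>Toggling \<open>i\<close> changes the number of elements below \<open>j\<close> by one
  if \<open>i < j\<close>, and not at all otherwise.\<close>

lemma fock_sign_toggle:
  "fock_sign j (toggle i S) = (if i < j then - fock_sign j S else fock_sign j S)"
proof (cases "i < j")
  case True
  \<comment> \<open>\<open>S\<close> itself may be infinite; only its part below \<open>j\<close> is
    counted.\<close>
  have fin: "finite {k \<in> S. k < j}"
    by (rule finite_subset[of _ "{..<j}"]) auto
  show ?thesis
  proof (cases "i \<in> S")
    case True
    have "{k \<in> toggle i S. k < j} = {k \<in> S. k < j} - {i}"
      using True by (auto simp: mem_toggle split: if_splits)
    moreover have "card {k \<in> S. k < j} = Suc (card ({k \<in> S. k < j} - {i}))"
      using True \<open>i < j\<close> fin by (intro card.remove) auto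
    ultimately show ?thesis
      using \<open>i < j\<close> by (simp add: fock_sign_def)
  next
    case False
    have "{k \<in> toggle i S. k < j} = insert i {k \<in> S. k < j}"
      using False \<open>i < j\<close> by (auto simp: mem_toggle split: if_splits)
    then show ?thesis
      using False \<open>i < j\<close> fin by (simp add: fock_sign_def)
  qed
next
  case False
  then have "{k \<in> toggle i S. k < j} = {k \<in> S. k < j}"
    by (auto simp: mem_toggle split: if_splits)
  then show ?thesis
    using False by (simp add: fock_sign_def)
qed

text \<open>Toggling \<open>i\<close> keeps the sign of \<open>i\<close> and flips its membership,
  so the two steps contribute one factor 1 and one factor \<open>- q i\<close>.\<close>

lemma fock_op_square: "fock_op q i (fock_op q i \<phi>) S = - q i * \<phi> S"
proof -
  have "fock_op q i (fock_op q i \<phi>) S = (fock_sign i S * fock_sign i S) * (- q i * \<phi> S)"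
    by (simp add: fock_op_def fock_sign_toggle mem_toggle)
  then show ?thesis
    by (simp add: fock_sign_square)
qed

text \<open>The toggles and the factors for \<open>i\<close> and \<open>j\<close> are independent;
  the signs differ because toggling the smaller index flips the sign of the larger but not
  conversely.\<close>

lemma fock_op_anticommute:
  assumes "i \<noteq> j"
  shows "fock_op q i (fock_op q j \<phi>) S + fock_op q j (fock_op q i \<phi>) S = 0"
  using assms
  by (cases i j rule: linorder_cases)
    (auto simp: fock_op_def fock_sign_toggle mem_toggle toggle_commute[of i j])

text \<open>The extension of the operators \<open>fock_op q i\<close> to all vectors, linear once
  \<open>c i v\<close> is the \<open>i\<close>-th coordinate of \<open>v\<close>.\<close>

definition fock_action ::
  "nat set \<Rightarrow> (nat \<Rightarrow> 'v \<Rightarrow> 'f::field) \<Rightarrow> (nat \<Rightarrow> 'f) \<Rightarrow> 'v \<Rightarrow> (nat set \<Rightarrow> 'f) \<Rightarrow> nat set \<Rightarrow> 'f"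
  where "fock_action A c q v \<phi> S = (\<Sum>i\<in>A. c i v * fock_op q i \<phi> S)"

lemma fock_op_fock_action:
  "fock_op q i (fock_action A c q v \<phi>) S = (\<Sum>j\<in>A. c j v * fock_op q i (fock_op q j \<phi>) S)"
  by (simp add: fock_op_def[of q i] fock_action_def sum_distrib_left mult_ac)

lemma fock_action_square:
  assumes "finite A"
  shows "fock_action A c q v (fock_action A c q v \<phi>) S = - (\<Sum>i\<in>A. c i v * c i v * q i) * \<phi> S"
proof -
  have "fock_action A c q v (fock_action A c q v \<phi>) S
      = (\<Sum>i\<in>A. \<Sum>j\<in>A. c i v * (c j v * fock_op q i (fock_op q j \<phi>) S))"
    by (simp add: fock_action_def[of A c q v "fock_action A c q v \<phi>"] fock_op_fock_action
        sum_distrib_left)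
  also have "\<dots> = (\<Sum>i\<in>A. c i v * (c i v * fock_op q i (fock_op q i \<phi>) S))"
  proof (rule sum_sum_antisymmetric[OF assms])
    fix i j :: nat assume "i \<noteq> j"
    have "c i v * (c j v * fock_op q i (fock_op q j \<phi>) S) + c j v * (c i v * fock_op q j (fock_op q i \<phi>) S)
        = c i v * c j v * (fock_op q i (fock_op q j \<phi>) S + fock_op q j (fock_op q i \<phi>) S)"
      by (simp add: algebra_simps)
    then show "c i v * (c j v * fock_op q i (fock_op q j \<phi>) S) + c j v * (c i v * fock_op q j (fock_op q i \<phi>) S) = 0"
      by (simp only: fock_op_anticommute[OF \<open>i \<noteq> j\<close>] mult_zero_right)
  qed
  also have "\<dots> = - (\<Sum>i\<in>A. c i v * c i v * q i) * \<phi> S"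
    by (simp add: fock_op_square sum_distrib_right sum_negf mult.assoc)
  finally show ?thesis .
qed

section \<open>The form in an orthogonal basis\<close>

lemma orthogonal_basis_form:
  assumes "symmetric_bilinear_form scale Q" "orthogonal_basis scale Q n e"
  defines "c \<equiv> \<lambda>i v. module.representation scale (e ` {1..n}) v (e i)"
  shows "Q v v = (\<Sum>i\<in>{1..n}. c i v * c i v * Q (e i) (e i))"
proof -
  interpret finite_dimensional_vector_space scale "e ` {1..n}"
    using assms(2) by (simp add: orthogonal_basis_def)
  have inj: "inj_on e {1..n}"
    and orth: "\<And>i j. i \<in> {1..n} \<Longrightarrow> j \<in> {1..n} \<Longrightarrow> i \<noteq> j \<Longrightarrow> Q (e i) (e j) = 0"
    using assms(2) unfolding orthogonal_basis_def by blast+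
  have linl: "module_hom scale (*) (\<lambda>u. Q u w)" and linr: "module_hom scale (*) (Q w)" for w
    using assms(1) unfolding symmetric_bilinear_form_def module_hom_iff_linear by blast+
  \<comment> \<open>Injectivity of \<open>e\<close> turns the sum over the basis set into a sum over
    indices.\<close>
  have v: "v = (\<Sum>i\<in>{1..n}. scale (c i v) (e i))"
    using sum_representation_eq[of "e ` {1..n}" v "e ` {1..n}"] inj
    by (simp add: independent_Basis span_Basis sum.reindex c_def del: One_nat_def)
  have left: "Q v w = (\<Sum>i\<in>{1..n}. c i v * Q (e i) w)" for w
    by (subst v) (simp add: module_hom.sum[OF linl] module_hom.scale[OF linl])
  have right: "Q w v = (\<Sum>i\<in>{1..n}. c i v * Q w (e i))" for w
    by (subst v) (simp add: module_hom.sum[OF linr] module_hom.scale[OF linr])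
  have "Q v v = (\<Sum>i\<in>{1..n}. \<Sum>j\<in>{1..n}. c i v * (c j v * Q (e i) (e j)))"
    by (subst left, subst right) (simp add: sum_distrib_left)
  also have "\<dots> = (\<Sum>i\<in>{1..n}. c i v * (c i v * Q (e i) (e i)))"
    by (rule sum_sum_antisymmetric) (simp_all add: orth)
  finally show ?thesis
    by (simp add: mult.assoc)
qed

text \<open>An isotropic basis vector would be orthogonal to the whole basis, hence to its span, and
  so be zero by nondegeneracy; this contradicts independence.\<close>

lemma orthogonal_basis_nonisotropic:
  assumes "symmetric_bilinear_form scale Q" "nondegenerate_form Q" "orthogonal_basis scale Q n e"
    and i: "i \<in> {1..n}"
  shows "Q (e i) (e i) \<noteq> 0"
proof
  assume zero: "Q (e i) (e i) = 0"
  interpret finite_dimensional_vector_space scale "e ` {1..n}"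
    using assms(3) by (simp add: orthogonal_basis_def)
  have lin: "module_hom scale (*) (Q (e i))"
    using assms(1) unfolding symmetric_bilinear_form_def module_hom_iff_linear by blast
  have "Q (e i) v = 0" for v
  proof (rule module_hom.eq_0_on_span[OF lin])
    show "v \<in> span (e ` {1..n})"
      unfolding span_Basis by simp
    show "Q (e i) b = 0" if b: "b \<in> e ` {1..n}" for b
    proof -
      obtain j where j: "j \<in> {1..n}" "b = e j"
        using b by blast
      then show ?thesis
        using assms(3) i zero unfolding orthogonal_basis_def by (cases "j = i") auto
    qed
  qed
  then have "e i = 0"
    using assms(2) by (simp add: nondegenerate_form_def)
  moreover have "e i \<in> e ` {1..n}"
    using i by blast
  ultimately show False
    using independent_Basis dependent_zero by metis
qed

lemma clifford_algebra_nontrivial: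
  fixes scale :: "'f::field \<Rightarrow> 'v::ab_group_add \<Rightarrow> 'v"
  assumes "symmetric_bilinear_form scale Q" "orthogonal_basis scale Q n e"
  shows "\<one>\<^bsub>clifford_algebra scale Q\<^esub> \<noteq> \<zero>\<^bsub>clifford_algebra scale Q\<^esub>"
proof -
  interpret V: finite_dimensional_vector_space scale "e ` {1..n}"
    using assms(2) by (simp add: orthogonal_basis_def)
  \<comment> \<open>The module is the full type of functions on sets of naturals, larger than the
    functions on subsets of \<open>{1..n}\<close>; this avoids a carrier set, and addition is
    pointwise.\<close>
  let ?scaleM = "\<lambda>(a :: 'f) (\<phi> :: nat set \<Rightarrow> 'f) S. a * \<phi> S"
  define c where "c = (\<lambda>i v. V.representation (e ` {1..n}) v (e i))"
  define \<rho> where "\<rho> = fock_action {1..n} c (\<lambda>i. Q (e i) (e i))"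
  interpret M: vector_space ?scaleM
    by unfold_locales (simp_all add: fun_eq_iff algebra_simps)
  have c: "c i (v + w) = c i v + c i w" "c i (scale a v) = a * c i v" for i v w a
    by (simp_all add: c_def V.representation_add V.representation_scale V.independent_Basis V.span_Basis
        del: One_nat_def)
  interpret clifford_module ?scaleM \<rho> scale Q
  proof
    show "\<rho> v (\<phi> + \<psi>) = \<rho> v \<phi> + \<rho> v \<psi>" "\<rho> v (?scaleM a \<phi>) = ?scaleM a (\<rho> v \<phi>)" for v \<phi> \<psi> a
      by (simp_all add: \<rho>_def fun_eq_iff fock_action_def fock_op_def algebra_simps sum.distrib
          sum_distrib_left sum_subtractf)
    show "\<rho> (v + w) \<phi> = \<rho> v \<phi> + \<rho> w \<phi>" "\<rho> (scale a v) \<phi> = ?scaleM a (\<rho> v \<phi>)" for v w \<phi> a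
      by (simp_all add: \<rho>_def fun_eq_iff fock_action_def c algebra_simps sum.distrib sum_distrib_left)
    show "\<rho> v (\<rho> v \<phi>) = ?scaleM (- Q v v) \<phi>" for v \<phi>
      using orthogonal_basis_form[OF assms, of v]
      by (simp add: \<rho>_def fun_eq_iff fock_action_square c_def)
  qed
  show ?thesis
    \<comment> \<open>The constant function 1 serves as the nonzero module element.\<close>
    by (rule clifford_one_not_zero[of "\<lambda>_. 1"]) (simp add: fun_eq_iff)
qed

theorem proposition3p2:
  fixes scale :: "'f::field \<Rightarrow> 'v::ab_group_add \<Rightarrow> 'v"
    and Q :: "'v \<Rightarrow> 'v \<Rightarrow> 'f"
    and e :: "nat \<Rightarrow> 'v"
    and n :: nat
    and I J :: "nat list"
  defines "C \<equiv> clifford_algebra scale Q"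
    and "m \<equiv> clifford_monomial scale Q e"
  assumes "CHAR('f) \<noteq> 2"
    and "vector_space scale"
    and "symmetric_bilinear_form scale Q"
    and "nondegenerate_form Q"
    and "orthogonal_basis scale Q n e"
    and "multi_index n I" and "multi_index n J"
    and "set I \<inter> set J \<noteq> {}"
  shows "(even (card (set I \<inter> set J)) \<longrightarrow>
            (m I \<otimes>\<^bsub>C\<^esub> m J = \<ominus>\<^bsub>C\<^esub> (m J \<otimes>\<^bsub>C\<^esub> m I)
              \<longleftrightarrow> odd (length I) \<and> odd (length J))) \<and>
         (odd (card (set I \<inter> set J)) \<longrightarrow>
            (m I \<otimes>\<^bsub>C\<^esub> m J = m J \<otimes>\<^bsub>C\<^esub> m I
              \<longleftrightarrow> odd (length I) \<and> odd (length J)))"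
proof -
  interpret C: ring C
    unfolding C_def by (rule ring_clifford_algebra)
  interpret anticommuting_family C "{1..n}" "\<lambda>i. clifford_vec scale Q (e i)"
  proof
    fix i j assume "i \<in> {1..n}" "j \<in> {1..n}" "i \<noteq> j"
    then have "Q (e i) (e j) = 0"
      using assms(7) unfolding orthogonal_basis_def by blast
    then show "clifford_vec scale Q (e i) \<otimes>\<^bsub>C\<^esub> clifford_vec scale Q (e j)
        = \<ominus>\<^bsub>C\<^esub> (clifford_vec scale Q (e j) \<otimes>\<^bsub>C\<^esub> clifford_vec scale Q (e i))"
      unfolding C_def by (rule clifford_vec_anticommute[OF assms(5)])
  qed (simp add: C_def clifford_vec_closed)
  have m: "m K = monomial K" for K
    by (simp add: m_def clifford_monomial_def C_def)
  \<comment> \<open>If 2 = 0 in the field, the characteristic divides 2, so it is 1 or 2; both are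
    excluded.\<close>
  have "CHAR('f) \<noteq> 1"
    by simp
  then have two: "(2 :: 'f) \<noteq> 0"
    using assms(3) of_nat_eq_0_iff_char_dvd[of 2, where ?'a = 'f] prime_nat_iff two_is_prime_nat
    by (metis of_nat_numeral)
  have range: "set I \<subseteq> {1..n}" "set J \<subseteq> {1..n}" and distinct: "distinct I" "distinct J"
    using assms(8,9) by (auto simp: multi_index_def strict_sorted_iff)
  have closed: "m I \<in> carrier C" "m J \<in> carrier C"
    unfolding m using range[THEN monomial_closed] by blast+
  have invertible: "\<exists>r\<in>carrier C. m K \<otimes>\<^bsub>C\<^esub> r = \<one>\<^bsub>C\<^esub>" if "set K \<subseteq> {1..n}" for K
    unfolding m
  proof (rule C.foldr_mult_right_invertible)
    fix i assume "i \<in> set K"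
    with that have i: "i \<in> {1..n}"
      by blast
    then show "\<exists>r\<in>carrier C. clifford_vec scale Q (e i) \<otimes>\<^bsub>C\<^esub> r = \<one>\<^bsub>C\<^esub>"
      unfolding C_def
      by (intro clifford_vec_right_invertible orthogonal_basis_nonisotropic[OF assms(5-7)])
  qed (simp add: C_def clifford_vec_closed)
  obtain r s where r: "r \<in> carrier C" "m J \<otimes>\<^bsub>C\<^esub> r = \<one>\<^bsub>C\<^esub>" and s: "s \<in> carrier C" "m I \<otimes>\<^bsub>C\<^esub> s = \<one>\<^bsub>C\<^esub>"
    using invertible range by meson
  let ?z = "m J \<otimes>\<^bsub>C\<^esub> m I"
  have z: "?z \<in> carrier C"
    using closed by simp
  have "?z \<otimes>\<^bsub>C\<^esub> (s \<otimes>\<^bsub>C\<^esub> r) = m J \<otimes>\<^bsub>C\<^esub> ((m I \<otimes>\<^bsub>C\<^esub> s) \<otimes>\<^bsub>C\<^esub> r)"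
    using closed r(1) s(1) by (simp add: C.m_assoc)
  then have inv: "?z \<otimes>\<^bsub>C\<^esub> (s \<otimes>\<^bsub>C\<^esub> r) = \<one>\<^bsub>C\<^esub>"
    using r s by simp
  \<comment> \<open>Since \<open>?z\<close> differs from its negative, the sign relating the two
    products is uniquely determined.\<close>
  have neq: "?z \<noteq> \<ominus>\<^bsub>C\<^esub> ?z"
    by (rule clifford_not_eq_minus[OF two clifford_algebra_nontrivial[OF assms(5,7)],
        folded C_def, OF z C.m_closed[OF s(1) r(1)] inv])
  let ?k = "\<Sum>i\<leftarrow>I. length (filter (\<lambda>j. j \<noteq> i) J)"
  have "m I \<otimes>\<^bsub>C\<^esub> m J = C.alt ?k ?z"
    unfolding m by (rule monomial_commute[OF range])
  \<comment> \<open>\<open>?k + card (set I \<inter> set J)\<close> equals the product of the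
    lengths, which is odd exactly when both lengths are. Hence an even intersection gives the sign
    -1 in precisely that case, and an odd one gives +1 there.\<close>
  moreover have "even (?k + card (set I \<inter> set J)) \<longleftrightarrow> \<not> (odd (length I) \<and> odd (length J))"
    using sum_list_filter_neq[OF distinct] by simp
  ultimately show ?thesis
    using neq by (auto simp: C.alt_def)
qed

end
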